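(* Consider the local beeping model. For any positive integer constant $n$ there exists a positive integer $c$, such that Algorithm Bounded-energy-RV-with-detection (with parameter $n$) can be executed by $c$-bounded agents in any graph of size at most $n$. If two such agents with distinct labels execute this algorithm in such a graph, then they meet and simultaneously declare rendezvous in time $O(\ell^* )$ after the start of the later agent, where $\ell^*$ is the larger label.
   Context: **Graphs.** A graph is a simple connected undirected graph; its size is its number of nodes. Nodes have no labels that agents can use. The edges incident to a node of degree $d$ have distinct port numbers $0,\dots,d-1$ at that node; there is no relation between the two port numbers of an edge at its two endpoints. **Agents.** Two deterministic agents have distinct labels that are positive integers. Each agent knows its own label but not the other's, and does not know the topology of the graph or the other agent's starting node or activation round; the bound $n$ on the size is a parameter of the algorithm. The agents start from arbitrary nodes in arbitrary, possibly different, rounds; each agent appears at its starting node when it is activated by an adversary. The later agent is the one activated later (chosen arbitrarily if they start simultaneously). Time proceeds in synchronous rounds. In each round an agent either stays at its current node or moves through a chosen port to a neighbor. On entering a node it learns the degree of the node and the port of entry. In each round an agent also either beeps or listens. A $c$-bounded agent is an agent that can perform at most $c$ moves; the number of beeps is not restricted. **Local beeping model.** An agent hears a beep in a round if it listens in this round and if the other agent is at the same node and beeps. **Exploration procedure $EXP(m)$.** There is a fixed infinite sequence $x_1,x_2,\dots$ of non-negative integers (a universal exploration sequence) and a polynomial $R$ such that the following walk of $R(m)$ steps visits all nodes of any graph of size at most $m$, starting from any node of this graph: in step 1 the agent leaves the starting node by port $0$; for $i\ge 1$, if the agent entered the current node of degree $d$ by port $p$ in step $i$, then in step $i+1$ it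 leaves by port $(p+x_i)\bmod d$. **Procedure Beeping exploration$(n)$.** Replace each round of $EXP(n)$ by three consecutive rounds: if in that round of $EXP(n)$ the agent takes port $p$ to move to node $w$, then in the first of the three rounds it takes port $p$ to move to $w$ and beeps, and in the second and third rounds it stays at $w$ and listens. **Algorithm Bounded-energy-RV-with-detection** (agent with label $L$, parameter $n$). The agent maintains a boolean variable $waiting$. After each round, *condition* is the boolean value of: ($waiting$ and you hear a beep) or (not $waiting$ and you hear beeps in two consecutive rounds). Perform the following actions in consecutive rounds, verifying *condition* in each round, until *condition* becomes true: (1) with $waiting$ = false, perform Beeping exploration$(n)$; (2) with $waiting$ = true, stay idle and listen for $6L\cdot R(n)$ rounds; (3) with $waiting$ = false, perform Beeping exploration$(n)$; (4) with $waiting$ = true, stay idle forever and listen. Let $s$ be the round number (counted since your wake-up) when *condition* becomes true. If $waiting$ is true, then beep in rounds $s+1$ and $s+2$, declare rendezvous in round $s+3$ and stop (staying idle at the node throughout). Otherwise declare rendezvous in round $s+1$ and stop (staying idle at the node).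
   Formalization: EXP(m) is required to visit every node, including its starting node, after at least one step; if merely starting there counts, the claim fails (two nodes, R(2)=1, labels 2 and 1, starts in rounds 0 and 6). Graph nodes are natural numbers. *)

theory Defs
  imports
    "HOL-Computational_Algebra.Polynomial"
    "Graph_Theory.Graph_Theory"
begin

section \<open>Anonymous port-labelled graphs\<close>

text \<open>
  In \<open>(G, \<pi>)\<close>, the number \<open>\<pi> u v\<close> is the port number at \<open>u\<close> of the edge between \<open>u\<close> and \<open>v\<close>.
\<close>

type_synonym 'v port_graph = "'v pair_pre_digraph \<times> ('v \<Rightarrow> 'v \<Rightarrow> nat)"

definition nodes :: "'v port_graph \<Rightarrow> 'v set" where
  "nodes N = pverts (fst N)"

definition neighbours :: "'v port_graph \<Rightarrow> 'v \<Rightarrow> 'v set" where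
  "neighbours N u = {v. (u, v) \<in> parcs (fst N)}"

definition degree_of :: "'v port_graph \<Rightarrow> 'v \<Rightarrow> nat" where
  "degree_of N u = card (neighbours N u)"

text \<open>
  Symmetric pairs of arcs (\<^locale>\<open>pair_graph\<close>) represent undirected edges; the library's
  connectedness includes that there is at least one node.
\<close>

definition port_labelled_graph :: "'v port_graph \<Rightarrow> bool" where
  "port_labelled_graph N \<longleftrightarrow>
     pair_graph (fst N) \<and> Digraph_Component.connected (with_proj (fst N)) \<and>
     (\<forall>u \<in> nodes N. bij_betw (snd N u) (neighbours N u) {..<degree_of N u})"

text \<open>
  The node reached when taking port \<open>p\<close> at \<open>u\<close>, and the port by which it is entered. There is
  no move (and no port of entry) if no port is taken. The same applies to a port that does not
  exist; for the algorithm below this only concerns port 0 in the graph with a single node.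
\<close>

definition traverse :: "'v port_graph \<Rightarrow> 'v \<Rightarrow> nat option \<Rightarrow> 'v \<times> nat option" where
  "traverse N u q =
     (case q of
        None \<Rightarrow> (u, None)
      | Some p \<Rightarrow>
          if p < degree_of N u
          then let v = (THE v. v \<in> neighbours N u \<and> snd N u v = p) in (v, Some (snd N v u))
          else (u, None))"


section \<open>Deterministic agents in the local beeping model\<close>

text \<open>
  An agent that does not beep listens. The component \<open>declares\<close> tells whether the agent declares
  rendezvous in this round.
\<close>

record action =
  takes_port :: "nat option"
  beeps :: bool
  declares :: bool

abbreviation stay_and_listen :: action where
  "stay_and_listen \<equiv> \<lparr>takes_port = None, beeps = False, declares = False\<rparr>"

text \<open>
  What an agent perceives in a round: the port of entry if it has moved to a new node, and
  whether it has heard a beep.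
\<close>

record percept =
  entered_by :: "nat option"
  hears :: bool

text \<open>
  An agent is a state machine over memory states \<open>'s\<close>. It starts with its own label only, chooses
  its action from its memory state and the degree of the current node, and then updates its
  memory state according to what it perceives.
\<close>

record 's algorithm =
  initial :: "nat \<Rightarrow> 's"
  select_action :: "'s \<Rightarrow> nat \<Rightarrow> action"
  update :: "'s \<Rightarrow> percept \<Rightarrow> 's"

record 'v agent =
  label :: nat
  start :: 'v
  wake :: nat

text \<open>
  The two agents are indexed by \<^typ>\<open>bool\<close>, so that the other agent of \<open>i\<close> is \<open>\<not> i\<close>. Rounds are
  numbered globally by \<open>0, 1, \<dots>\<close>; agent \<open>i\<close> is present from round \<open>wake (A i)\<close> on, which is its
  first round of execution. In a round, an agent first makes its move (if any); its beeping or
  listening in this round then takes place at the node it has arrived at.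
\<close>

type_synonym ('v, 's) configuration = "bool \<Rightarrow> 'v \<times> 's"

definition act ::
  "'s algorithm \<Rightarrow> 'v port_graph \<Rightarrow> ('v, 's) configuration \<Rightarrow> bool \<Rightarrow> action" where
  "act alg N S i = select_action alg (snd (S i)) (degree_of N (fst (S i)))"

definition arrival ::
  "'s algorithm \<Rightarrow> 'v port_graph \<Rightarrow> ('v, 's) configuration \<Rightarrow> bool \<Rightarrow> 'v \<times> nat option" where
  "arrival alg N S i = traverse N (fst (S i)) (takes_port (act alg N S i))"

definition hears_beep ::
  "'s algorithm \<Rightarrow> 'v port_graph \<Rightarrow> (bool \<Rightarrow> 'v agent) \<Rightarrow> nat \<Rightarrow> ('v, 's) configuration \<Rightarrow> bool \<Rightarrow> bool"
  where
  "hears_beep alg N A t S i \<longleftrightarrow>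
     wake (A i) \<le> t \<and> \<not> beeps (act alg N S i) \<and>
     wake (A (\<not> i)) \<le> t \<and> beeps (act alg N S (\<not> i)) \<and>
     fst (arrival alg N S i) = fst (arrival alg N S (\<not> i))"

text \<open>\<open>execution alg N A t\<close> is the configuration at the beginning of round \<open>t\<close>.\<close>

primrec execution ::
  "'s algorithm \<Rightarrow> 'v port_graph \<Rightarrow> (bool \<Rightarrow> 'v agent) \<Rightarrow> nat \<Rightarrow> ('v, 's) configuration" where
  "execution alg N A 0 = (\<lambda>i. (start (A i), initial alg (label (A i))))"
| "execution alg N A (Suc t) =
     (let S = execution alg N A t in
      (\<lambda>i. if wake (A i) \<le> t
          then (fst (arrival alg N S i),
                update alg (snd (S i))
                  \<lparr>entered_by = snd (arrival alg N S i), hears = hears_beep alg N A t S i\<rparr>)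
          else S i))"

definition move_rounds ::
  "'s algorithm \<Rightarrow> 'v port_graph \<Rightarrow> (bool \<Rightarrow> 'v agent) \<Rightarrow> bool \<Rightarrow> nat set" where
  "move_rounds alg N A i =
     {t. wake (A i) \<le> t \<and> snd (arrival alg N (execution alg N A t) i) \<noteq> None}"

definition c_bounded ::
  "nat \<Rightarrow> 's algorithm \<Rightarrow> 'v port_graph \<Rightarrow> (bool \<Rightarrow> 'v agent) \<Rightarrow> bool \<Rightarrow> bool" where
  "c_bounded c alg N A i \<longleftrightarrow>
     finite (move_rounds alg N A i) \<and> card (move_rounds alg N A i) \<le> c"

definition meet_in_round ::
  "'s algorithm \<Rightarrow> 'v port_graph \<Rightarrow> (bool \<Rightarrow> 'v agent) \<Rightarrow> nat \<Rightarrow> bool" where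
  "meet_in_round alg N A t \<longleftrightarrow>
     wake (A False) \<le> t \<and> wake (A True) \<le> t \<and>
     fst (arrival alg N (execution alg N A t) False) =
     fst (arrival alg N (execution alg N A t) True)"

definition declares_in_round ::
  "'s algorithm \<Rightarrow> 'v port_graph \<Rightarrow> (bool \<Rightarrow> 'v agent) \<Rightarrow> bool \<Rightarrow> nat \<Rightarrow> bool" where
  "declares_in_round alg N A i t \<longleftrightarrow>
     wake (A i) \<le> t \<and> declares (act alg N (execution alg N A t) i)"

definition admissible :: "nat \<Rightarrow> 'v port_graph \<Rightarrow> (bool \<Rightarrow> 'v agent) \<Rightarrow> bool" where
  "admissible n N A \<longleftrightarrow>
     port_labelled_graph N \<and> card (nodes N) \<le> n \<and>
     (\<forall>i. start (A i) \<in> nodes N \<and> label (A i) \<ge> 1) \<and>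
     label (A False) \<noteq> label (A True)"


section \<open>The exploration procedure\<close>

text \<open>
  \<open>exp_port x i p d\<close> is the port taken in step \<open>i + 1\<close> at a node of degree \<open>d\<close>
  that was entered by port \<open>p\<close>; \<open>p\<close> is irrelevant for \<open>i = 0\<close>. The value \<open>x 0\<close> is not used.
\<close>

definition exp_port :: "(nat \<Rightarrow> nat) \<Rightarrow> nat \<Rightarrow> nat \<Rightarrow> nat \<Rightarrow> nat" where
  "exp_port x i p d = (if i = 0 then 0 else (p + x i) mod d)"

text \<open>Node and port of entry after the given number of steps.\<close>

primrec exp_walk :: "(nat \<Rightarrow> nat) \<Rightarrow> 'v port_graph \<Rightarrow> 'v \<Rightarrow> nat \<Rightarrow> 'v \<times> nat" where
  "exp_walk x N v 0 = (v, 0)"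
| "exp_walk x N v (Suc i) =
     (let (u, p) = exp_walk x N v i;
          (w, q) = traverse N u (Some (exp_port x i p (degree_of N u)))
      in (w, case q of None \<Rightarrow> p | Some p' \<Rightarrow> p'))"

text \<open>
  The nodes visited by \<open>EXP m\<close> are those at which the agent is in one of the rounds \<open>1, \<dots>, R m\<close>
  of the procedure, i.e., after at least one step. Merely having been placed at the starting
  node does not count as a visit in one of these rounds: the procedure below does not beep there
  unless the walk comes back, and with the weaker reading the algorithm can fail (for
  instance, in the graph with two nodes if \<open>R 2 = 1\<close>, when the later agent appears at the
  node where the earlier one is waiting).

  Nodes are anonymous, so it is no restriction to take natural numbers as nodes.
\<close>

definition exploration_procedure :: "(nat \<Rightarrow> nat) \<Rightarrow> (nat \<Rightarrow> nat) \<Rightarrow> bool" where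
  "exploration_procedure x R \<longleftrightarrow>
     (\<exists>P :: real poly. \<forall>m \<ge> 1. real (R m) = poly P (real m)) \<and>
     (\<forall>m \<ge> 1. \<forall>N :: nat port_graph. port_labelled_graph N \<and> card (nodes N) \<le> m \<longrightarrow>
        (\<forall>v \<in> nodes N. \<forall>w \<in> nodes N. \<exists>i \<in> {1..R m}. fst (exp_walk x N v i) = w))"


section \<open>Algorithm Bounded-energy-RV-with-detection\<close>

text \<open>
  \<open>Searching\<close>: the condition has not yet become true. \<open>Answer1\<close>, \<open>Answer2\<close>: the two
  rounds of beeping after it has become true while waiting. \<open>Declaring\<close>: the round in which
  rendezvous is declared.
\<close>

datatype mode = Searching | Answer1 | Answer2 | Declaring | Stopped

record memory =
  own_label :: nat
  mode :: mode
  clock :: nat  \<comment> \<open>completed rounds since the wake-up\<close>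
  entry_port :: nat
  heard_last :: bool  \<comment> \<open>a beep was heard in the previous round\<close>

text \<open>
  With \<open>r = R n\<close>, \<open>exploration_round r L k\<close> is \<open>Some j\<close> if round \<open>k + 1\<close> since the wake-up is
  round \<open>j + 1\<close> of one of the two executions of Beeping exploration (each of which takes
  \<open>3 * r\<close> rounds), and \<open>None\<close> in the periods of waiting.
\<close>

definition exploration_round :: "nat \<Rightarrow> nat \<Rightarrow> nat \<Rightarrow> nat option" where
  "exploration_round r L k =
     (if k < 3 * r then Some k
      else if k < 3 * r + 6 * L * r then None
      else if k < 3 * r + 6 * L * r + 3 * r then Some (k - (3 * r + 6 * L * r))
      else None)"

definition waiting :: "nat \<Rightarrow> memory \<Rightarrow> bool" where
  "waiting r s \<longleftrightarrow> exploration_round r (own_label s) (clock s) = None"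

definition beeping_exploration :: "(nat \<Rightarrow> nat) \<Rightarrow> nat \<Rightarrow> nat \<Rightarrow> nat \<Rightarrow> action" where
  "beeping_exploration x j p d =
     (if j mod 3 = 0
      then \<lparr>takes_port = Some (exp_port x (j div 3) p d), beeps = True, declares = False\<rparr>
      else stay_and_listen)"

definition rv_choose :: "(nat \<Rightarrow> nat) \<Rightarrow> nat \<Rightarrow> memory \<Rightarrow> nat \<Rightarrow> action" where
  "rv_choose x r s d =
     (case mode s of
        Searching \<Rightarrow>
          (case exploration_round r (own_label s) (clock s) of
             None \<Rightarrow> stay_and_listen
           | Some j \<Rightarrow> beeping_exploration x j (entry_port s) d)
      | Answer1 \<Rightarrow> stay_and_listen\<lparr>beeps := True\<rparr>
      | Answer2 \<Rightarrow> stay_and_listen\<lparr>beeps := True\<rparr>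
      | Declaring \<Rightarrow> stay_and_listen\<lparr>declares := True\<rparr>
      | Stopped \<Rightarrow> stay_and_listen)"

definition stop_condition :: "nat \<Rightarrow> memory \<Rightarrow> bool \<Rightarrow> bool" where
  "stop_condition r s h \<longleftrightarrow>
     (waiting r s \<and> h) \<or> (\<not> waiting r s \<and> heard_last s \<and> h)"

definition rv_update :: "nat \<Rightarrow> memory \<Rightarrow> percept \<Rightarrow> memory" where
  "rv_update r s o' =
     s\<lparr>mode :=
         (case mode s of
            Searching \<Rightarrow>
              (if \<not> stop_condition r s (hears o') then Searching
               else if waiting r s then Answer1
               else Declaring)
          | Answer1 \<Rightarrow> Answer2
          | Answer2 \<Rightarrow> Declaring
          | Declaring \<Rightarrow> Stopped
          | Stopped \<Rightarrow> Stopped),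
       clock := Suc (clock s),
       entry_port := (case entered_by o' of None \<Rightarrow> entry_port s | Some p \<Rightarrow> p),
       heard_last := hears o'\<rparr>"

definition bounded_energy_RV :: "(nat \<Rightarrow> nat) \<Rightarrow> (nat \<Rightarrow> nat) \<Rightarrow> nat \<Rightarrow> memory algorithm" where
  "bounded_energy_RV x R n =
     \<lparr>initial = (\<lambda>L. \<lparr>own_label = L, mode = Searching, clock = 0, entry_port = 0, heard_last = False\<rparr>),
      select_action = rv_choose x (R n),
      update = rv_update (R n)\<rparr>"

end

(*
  The first agent to stop searching does so while waiting: a searching agent never beeps in two
  consecutive rounds, so an exploring agent needs an answer first. At that contact the explorer
  stays for its two listening rounds, hears both answering beeps, and the two agents declare
  together three rounds after the contact. A contact occurs because distinct labels force some
  complete exploration of one agent, starting after both have woken up, to fall into a waiting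
  period of the other: if the first exploration of the later agent does not (it overlaps an
  exploration of the earlier agent), then one of the second explorations does.
*)
theory Submission
  imports Defs
begin

section \<open>The schedule: arithmetic of exploration and waiting periods\<close>

lemma exploration_round_eq_None_iff:
  "exploration_round r L k = None \<longleftrightarrow>
     3 * r \<le> k \<and> k < 3 * r + 6 * L * r \<or> 6 * r + 6 * L * r \<le> k"
  by (auto simp: exploration_round_def)

lemma exploration_round_eq_Some_iff:
  "exploration_round r L k = Some j \<longleftrightarrow>
     j < 3 * r \<and> (k = j \<or> k = 3 * r + 6 * L * r + j)"
  by (auto simp: exploration_round_def)

text \<open>The length \<open>3 * r\<close> is a multiple of 3, so an exploration never ends inside
  a block of three rounds: a beeping round is always followed by its two listening rounds.\<close>

lemma exploration_round_Suc:
  assumes "exploration_round r L k = Some j" and "j mod 3 < 2"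
  shows "exploration_round r L (Suc k) = Some (Suc j)"
proof -
  have "j < 3 * r \<Longrightarrow> Suc j < 3 * r"
    using assms(2) by presburger
  then show ?thesis
    using assms(1) by (auto simp: exploration_round_eq_Some_iff)
qed

lemma no_consecutive_beep_rounds:
  assumes "exploration_round r L k = Some j" and "j mod 3 = 0"
    and "exploration_round r L (Suc k) = Some j'"
  shows "j' mod 3 \<noteq> 0"
  using exploration_round_Suc[OF assms(1)] assms(2,3) by (auto simp: mod_Suc)

text \<open>Distinct labels make the waiting periods differ by at least \<open>6 * r\<close>, the
  length of two explorations, which suffices to pull the second explorations apart. \<open>B\<close>
  is the global round in which the undisturbed exploration starts; the agent with \<open>w\<close>
  and \<open>L\<close> wakes first.\<close>

lemma undisturbed_exploration:
  fixes r w w' L L' :: nat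
  assumes "w \<le> w'" and "L \<noteq> L'" and "L \<ge> 1" and "L' \<ge> 1"
  obtains (earlier) B where "w' \<le> B" "B \<le> w' + 3 * r + 6 * L * r"
      "\<And>j. j < 3 * r \<Longrightarrow> exploration_round r L (B + j - w) = Some j"
      "\<And>j. j < 3 * r \<Longrightarrow> exploration_round r L' (B + j - w') = None"
    | (later) B where "w' \<le> B" "B \<le> w' + 3 * r + 6 * L' * r"
      "\<And>j. j < 3 * r \<Longrightarrow> exploration_round r L' (B + j - w') = Some j"
      "\<And>j. j < 3 * r \<Longrightarrow> exploration_round r L (B + j - w) = None"
proof -
  define X X' where "X = 6 * L * r" and "X' = 6 * L' * r"
  have X: "6 * r \<le> X" "6 * r \<le> X'"
    using assms(3,4) by (auto simp: X_def X'_def)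
  have less: "6 * l * r + 6 * r \<le> 6 * l' * r" if "l < l'" for l l' :: nat
  proof -
    have "(l + 1) * (6 * r) \<le> l' * (6 * r)"
      using that by (intro mult_right_mono) auto
    then show ?thesis by (simp add: algebra_simps)
  qed
  note round_simps = exploration_round_eq_Some_iff exploration_round_eq_None_iff
    X_def[symmetric] X'_def[symmetric]
  \<comment> \<open>Respectively: the first exploration of the later agent lies in one of the two
    waiting periods of the earlier agent; its second exploration starts once the earlier agent waits
    forever; the first explorations overlap and the earlier agent has the larger label.\<close>
  consider
      (first) "w + 3 * r \<le> w'" "w' + 3 * r \<le> w + 3 * r + X \<or> w + 6 * r + X \<le> w'"
    | (second) "w + 6 * r + X \<le> w' + 3 * r + X'"
    | (second_earlier) "w' < w + 3 * r" "L' < L"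
  proof (cases "w' < w + 3 * r")
    case True
    show ?thesis
    proof (cases "L < L'")
      case True
      then show ?thesis using less[OF True] assms(1) by (intro that(2)) (auto simp: X_def X'_def)
    next
      case False
      then show ?thesis using that(3) True assms(2) by simp
    qed
  next
    case False
    \<comment> \<open>If \<open>first\<close> fails, then \<open>w + X < w'\<close>, and
      \<open>6 * r \<le> X'\<close> delays the second exploration of the later agent enough for
      \<open>second\<close>.\<close>
    then show ?thesis using that(1,2) X by linarith
  qed
  then show ?thesis
  proof cases
    case first
    then show ?thesis
      by (intro later[of w']) (auto simp: round_simps)
  next
    case second
    then show ?thesis
      by (intro later[of "w' + 3 * r + X'"]) (use assms(1) in \<open>auto simp: round_simps\<close>)
  next
    case second_earlier
    \<comment> \<open>Hence \<open>w' + 6 * r + X' < w + 9 * r + X' \<le> w + 3 * r + X\<close>: the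
      later agent waits forever when the earlier one starts its second exploration.\<close>
    then have "X' + 6 * r \<le> X"
      using less[of L' L] by (simp add: X_def X'_def)
    then show ?thesis
      using second_earlier assms(1) X
      by (intro earlier[of "w + 3 * r + X"]) (auto simp: round_simps)
  qed
qed

section \<open>Moves along ports\<close>

lemma traverse_None [simp]: "traverse N u None = (u, None)"
  by (simp add: traverse_def)

lemma traverse_in_nodes:
  assumes "port_labelled_graph N" and "u \<in> nodes N"
  shows "fst (traverse N u q) \<in> nodes N"
proof (cases "\<exists>p. q = Some p \<and> p < degree_of N u")
  case True
  then obtain p where p: "q = Some p" "p < degree_of N u"
    by blast
  have "pair_graph (fst N)"
    using assms(1) by (simp add: port_labelled_graph_def)
  then interpret pair_graph "fst N" .
  have bij: "bij_betw (snd N u) (neighbours N u) {..<degree_of N u}"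
    using assms by (simp add: port_labelled_graph_def)
  \<comment> \<open>Bijectivity of the port numbering justifies the definite description in
    \<open>traverse\<close>.\<close>
  have "\<exists>!v. v \<in> neighbours N u \<and> snd N u v = p"
  proof -
    have "p \<in> snd N u ` neighbours N u"
      using bij p(2) by (simp add: bij_betw_def)
    then show ?thesis
      using bij_betw_imp_inj_on[OF bij] by (auto dest: inj_onD)
  qed
  from theI'[OF this] have "(THE v. v \<in> neighbours N u \<and> snd N u v = p) \<in> neighbours N u"
    by (rule conjunct1)
  then have "(THE v. v \<in> neighbours N u \<and> snd N u v = p) \<in> nodes N"
    using in_arcsD2 by (auto simp: neighbours_def nodes_def)
  then show ?thesis
    using p by (simp add: traverse_def Let_def)
next
  case False
  then show ?thesis
    using assms(2) by (auto simp: traverse_def split: option.split)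
qed

text \<open>The exploration property is assumed for the one graph \<open>N\<close> only, so the node
  type can stay arbitrary although \<open>exploration_procedure\<close> speaks of graphs on
  \<open>nat\<close>.\<close>

locale rv_execution =
  fixes x R :: "nat \<Rightarrow> nat" and n :: nat
    and N :: "'v port_graph" and A :: "bool \<Rightarrow> 'v agent"
  assumes admissible: "admissible n N A"
    and exploring: "\<And>v w. v \<in> nodes N \<Longrightarrow> w \<in> nodes N \<Longrightarrow>
      \<exists>i \<in> {1..R n}. fst (exp_walk x N v i) = w"
begin

abbreviation "alg \<equiv> bounded_energy_RV x R n"
abbreviation "conf \<equiv> execution alg N A"
abbreviation "position t i \<equiv> fst (conf t i)"
abbreviation "mem t i \<equiv> snd (conf t i)"
abbreviation "destination t i \<equiv> fst (arrival alg N (conf t) i)"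
abbreviation "hears_at t i \<equiv> hears_beep alg N A t (conf t) i"

text \<open>This is the schedule alone, independent of the mode. Truncated subtraction gives a
  sleeping agent the phase of its first round, hence the explicit wake-up hypotheses below.\<close>

definition phase :: "nat \<Rightarrow> bool \<Rightarrow> nat option" where
  "phase t i = exploration_round (R n) (label (A i)) (t - wake (A i))"

definition searching :: "nat \<Rightarrow> bool \<Rightarrow> bool" where
  "searching t i \<longleftrightarrow> mode (mem t i) = Searching"

lemma label_pos: "label (A i) \<ge> 1"
  using admissible by (simp add: admissible_def)

lemma label_neq: "label (A i) \<noteq> label (A (\<not> i))"
  using admissible by (cases i) (auto simp: admissible_def)

section \<open>The state of an agent, round by round\<close>

lemma act_eq: "act alg N (conf t) i = rv_choose x (R n) (mem t i) (degree_of N (position t i))"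
  by (simp add: act_def bounded_energy_RV_def)

lemma conf_Suc:
  assumes "wake (A i) \<le> t"
  shows "position (Suc t) i = destination t i"
    and "mem (Suc t) i = rv_update (R n) (mem t i)
      \<lparr>entered_by = snd (arrival alg N (conf t) i), hears = hears_at t i\<rparr>"
  using assms by (simp_all add: bounded_energy_RV_def Let_def)

lemma conf_asleep:
  assumes "t \<le> wake (A i)"
  shows "conf t i = (start (A i), initial alg (label (A i)))"
  using assms by (induction t) (auto simp: Let_def)

lemma conf_Suc_asleep:
  assumes "\<not> wake (A i) \<le> t"
  shows "conf (Suc t) i = conf t i"
  using assms by (simp add: Let_def)

declare execution.simps [simp del]

lemma own_label_mem [simp]: "own_label (mem t i) = label (A i)"
proof (induction t)
  case 0
  then show ?case by (simp add: execution.simps bounded_energy_RV_def)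
next
  case (Suc t)
  then show ?case
    by (cases "wake (A i) \<le> t") (simp_all add: conf_Suc conf_Suc_asleep rv_update_def)
qed

lemma clock_mem [simp]: "clock (mem t i) = t - wake (A i)"
proof (induction t)
  case 0
  then show ?case by (simp add: execution.simps bounded_energy_RV_def)
next
  case (Suc t)
  then show ?case
    by (cases "wake (A i) \<le> t") (simp_all add: conf_Suc conf_Suc_asleep rv_update_def Suc_diff_le)
qed

lemma waiting_mem [simp]: "waiting (R n) (mem t i) \<longleftrightarrow> phase t i = None"
  by (simp add: waiting_def phase_def)

lemma position_in_nodes: "position t i \<in> nodes N"
proof (induction t)
  case 0
  then show ?case using admissible by (simp add: execution.simps admissible_def)
next
  case (Suc t)
  have "port_labelled_graph N" using admissible by (simp add: admissible_def)
  from traverse_in_nodes[OF this Suc] show ?case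
    using Suc by (cases "wake (A i) \<le> t") (auto simp: conf_Suc conf_Suc_asleep arrival_def)
qed

lemma act_searching:
  assumes "searching t i"
  shows "act alg N (conf t) i = (case phase t i of
      None \<Rightarrow> stay_and_listen
    | Some j \<Rightarrow> beeping_exploration x j (entry_port (mem t i)) (degree_of N (position t i)))"
  using assms by (simp add: act_eq rv_choose_def searching_def phase_def)

lemma beeps_searching:
  assumes "searching t i"
  shows "beeps (act alg N (conf t) i) \<longleftrightarrow> (\<exists>j. phase t i = Some j \<and> j mod 3 = 0)"
  using assms by (auto simp: act_searching beeping_exploration_def split: option.split)

lemma arrival_staying:
  assumes "takes_port (act alg N (conf t) i) = None"
  shows "arrival alg N (conf t) i = (position t i, None)"
  using assms by (simp add: arrival_def)

section \<open>The bound on the number of moves\<close>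

lemma takes_port_imp_exploring:
  assumes "takes_port (act alg N (conf t) i) \<noteq> None"
  shows "phase t i \<noteq> None"
  using assms by (auto simp: act_eq rv_choose_def phase_def split: mode.splits option.splits)

lemma move_rounds_subset:
  "move_rounds alg N A i \<subseteq>
     {wake (A i)..<wake (A i) + 3 * R n} \<union>
     {wake (A i) + 3 * R n + 6 * label (A i) * R n..<wake (A i) + 6 * R n + 6 * label (A i) * R n}"
proof
  fix t assume t: "t \<in> move_rounds alg N A i"
  then have "wake (A i) \<le> t" "phase t i \<noteq> None"
    using takes_port_imp_exploring[of t i] arrival_staying[of t i]
    by (cases "takes_port (act alg N (conf t) i)"; simp add: move_rounds_def)+
  then show "t \<in> {wake (A i)..<wake (A i) + 3 * R n} \<union>
     {wake (A i) + 3 * R n + 6 * label (A i) * R n..<wake (A i) + 6 * R n + 6 * label (A i) * R n}"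
    by (auto simp: phase_def exploration_round_eq_None_iff)
qed

text \<open>All rounds of both explorations are counted, moving or not. The label only shifts the
  second interval, so the bound is the same for all labels.\<close>

lemma c_bounded_energy: "c_bounded (6 * R n) alg N A i"
proof -
  let ?U = "{wake (A i)..<wake (A i) + 3 * R n} \<union>
    {wake (A i) + 3 * R n + 6 * label (A i) * R n..<wake (A i) + 6 * R n + 6 * label (A i) * R n}"
  have "card ?U \<le> 6 * R n"
    by (rule order.trans[OF card_Un_le]) simp
  moreover have "card (move_rounds alg N A i) \<le> card ?U"
    by (rule card_mono[OF _ move_rounds_subset]) simp
  moreover have "finite (move_rounds alg N A i)"
    by (rule finite_subset[OF move_rounds_subset]) simp
  ultimately show ?thesis
    by (simp add: c_bounded_def)
qed

section \<open>Contacts, and why nobody stops before one\<close>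

text \<open>The roles are asymmetric: \<open>i\<close> explores and beeps, the other agent waits and
  hears it. Stated by schedule and position, a contact can be derived from the walk alone.\<close>

definition contact :: "nat \<Rightarrow> bool \<Rightarrow> bool" where
  "contact t i \<longleftrightarrow>
     wake (A i) \<le> t \<and> wake (A (\<not> i)) \<le> t \<and> searching t i \<and> searching t (\<not> i) \<and>
     (\<exists>j. phase t i = Some j \<and> j mod 3 = 0) \<and> phase t (\<not> i) = None \<and>
     destination t i = destination t (\<not> i)"

text \<open>The induction treats both agents at once, because what one hears is governed by the
  schedule only while the other is searching. The clause on \<open>heard_last\<close> carries the
  beep of the previous round over to the two-beep condition.\<close>

lemma searching_before_contact:
  assumes "\<And>s i. s < t \<Longrightarrow> \<not> contact s i"
  shows "searching t i \<and> (heard_last (mem t i) \<longrightarrow>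
    (\<exists>s j. t = Suc s \<and> wake (A (\<not> i)) \<le> s \<and> phase s (\<not> i) = Some j \<and> j mod 3 = 0))"
  using assms
proof (induction t arbitrary: i)
  case 0
  then show ?case by (simp add: execution.simps bounded_energy_RV_def searching_def)
next
  case (Suc t)
  have IH: "searching t i \<and> (heard_last (mem t i) \<longrightarrow>
    (\<exists>s j. t = Suc s \<and> wake (A (\<not> i)) \<le> s \<and> phase s (\<not> i) = Some j \<and> j mod 3 = 0))" for i
    using Suc by auto
  show ?case
  proof (cases "wake (A i) \<le> t")
    case False
    then show ?thesis
      using conf_asleep[of "Suc t" i] by (simp add: bounded_energy_RV_def searching_def)
  next
    case True
    have hears: "wake (A (\<not> i)) \<le> t \<and> (\<exists>j. phase t (\<not> i) = Some j \<and> j mod 3 = 0) \<and>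
        destination t i = destination t (\<not> i)" if "hears_at t i"
      using that IH[of "\<not> i"] by (simp add: hears_beep_def beeps_searching)
    have "\<not> stop_condition (R n) (mem t i) (hears_at t i)"
    proof
      assume stop: "stop_condition (R n) (mem t i) (hears_at t i)"
      then have h: "hears_at t i" by (auto simp: stop_condition_def)
      show False
      proof (cases "phase t i = None")
        case None: True
        \<comment> \<open>A beep heard while waiting is a contact with the other agent as the
          explorer.\<close>
        have "contact t (\<not> i)"
          using hears[OF h] True None IH[of i] IH[of "\<not> i"] by (simp add: contact_def)
        then show False using Suc.prems by blast
      next
        case False
        then have "heard_last (mem t i)" using stop by (auto simp: stop_condition_def)
        with IH[of i] obtain s j where s: "t = Suc s" "wake (A (\<not> i)) \<le> s"
            "phase s (\<not> i) = Some j" "j mod 3 = 0"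
          by (elim conjE impE exE)
        \<comment> \<open>An exploring agent would need the other one, still searching, to beep in
          rounds \<open>s\<close> and \<open>Suc s\<close>.\<close>
        then show False
          using no_consecutive_beep_rounds[of "R n" "label (A (\<not> i))" "s - wake (A (\<not> i))" j]
            hears[OF h] by (auto simp: phase_def Suc_diff_le)
      qed
    qed
    then have "searching (Suc t) i"
      using IH True by (simp add: searching_def conf_Suc rv_update_def)
    moreover have "heard_last (mem (Suc t) i) = hears_at t i"
      using True by (simp add: conf_Suc rv_update_def)
    ultimately show ?thesis using hears by auto
  qed
qed

section \<open>Positions during explorations and waiting periods\<close>

text \<open>
  The port of entry need not agree before the first step, since the second exploration starts
  with the port remembered from the first one, nor at a node of degree 0, where no port is ever
  entered; in neither case does the next step depend on it.
\<close>

lemma exploration_follows_walk: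
  assumes awake: "wake (A i) \<le> B"
    and phase: "\<And>j. j < 3 * R n \<Longrightarrow> phase (B + j) i = Some j"
    and search: "\<And>t. t \<le> B + 3 * m \<Longrightarrow> searching t i"
    and "m \<le> R n"
  shows "position (B + 3 * m) i = fst (exp_walk x N (position B i) m) \<and>
    (m = 0 \<or> degree_of N (position (B + 3 * m) i) = 0 \<or>
     entry_port (mem (B + 3 * m) i) = snd (exp_walk x N (position B i) m))"
  using search \<open>m \<le> R n\<close>
proof (induction m)
  case 0
  then show ?case by simp
next
  case (Suc m)
  let ?t = "B + 3 * m"
  let ?W = "exp_walk x N (position B i)"
  let ?u = "position ?t i"
  let ?q = "exp_port x m (entry_port (mem ?t i)) (degree_of N ?u)"
  have u: "?u = fst (?W m)"
    and p: "m = 0 \<or> degree_of N ?u = 0 \<or> entry_port (mem ?t i) = snd (?W m)"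
    using Suc by auto
  have search: "searching ?t i" "searching (Suc ?t) i" "searching (Suc (Suc ?t)) i"
    using Suc.prems(1) by auto
  have phases: "phase ?t i = Some (3 * m)" "phase (Suc ?t) i = Some (3 * m + 1)"
      "phase (Suc (Suc ?t)) i = Some (3 * m + 2)"
    using phase[of "3 * m"] phase[of "3 * m + 1"] phase[of "3 * m + 2"] Suc.prems(2) by simp_all
  have awakes: "wake (A i) \<le> ?t" "wake (A i) \<le> Suc ?t" "wake (A i) \<le> Suc (Suc ?t)"
    using awake by auto
  have arr0: "arrival alg N (conf ?t) i = traverse N ?u (Some ?q)"
    by (simp add: arrival_def act_searching[OF search(1)] phases beeping_exploration_def)
  have arr1: "arrival alg N (conf (Suc ?t)) i = (position (Suc ?t) i, None)"
    by (rule arrival_staying)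
      (simp add: act_searching[OF search(2)] phases beeping_exploration_def mod_Suc)
  have arr2: "arrival alg N (conf (Suc (Suc ?t))) i = (position (Suc (Suc ?t)) i, None)"
    by (rule arrival_staying)
      (simp add: act_searching[OF search(3)] phases beeping_exploration_def mod_Suc)
  have t3: "B + 3 * Suc m = Suc (Suc (Suc ?t))" by simp
  have pos: "position (B + 3 * Suc m) i = fst (traverse N ?u (Some ?q))"
    unfolding t3 by (simp add: conf_Suc awakes arr0 arr1 arr2)
  have entry: "entry_port (mem (B + 3 * Suc m) i) =
      (case snd (traverse N ?u (Some ?q)) of None \<Rightarrow> entry_port (mem ?t i) | Some p \<Rightarrow> p)"
    unfolding t3 by (simp add: conf_Suc awakes arr0 arr1 arr2 rv_update_def)
  have walk: "?W (Suc m) = (let (w, q) = traverse N ?u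
        (Some (exp_port x m (snd (?W m)) (degree_of N ?u)))
      in (w, case q of None \<Rightarrow> snd (?W m) | Some p' \<Rightarrow> p'))"
    by (simp add: u split_beta Let_def)
  show ?case
  proof (cases "degree_of N ?u = 0")
    case True
    then have "traverse N ?u (Some q) = (?u, None)" for q
      by (simp add: traverse_def)
    then show ?thesis
      using True pos by (simp add: walk del: exp_walk.simps mult_Suc_right)
  next
    case False
    have same_port: "exp_port x m (snd (?W m)) (degree_of N ?u) = ?q"
      using p False by (auto simp: exp_port_def)
    \<comment> \<open>The port exists, so a port of entry is stored and agrees with the walk from
      here on.\<close>
    have "?q < degree_of N ?u"
      using False by (cases "m = 0") (simp_all add: exp_port_def)
    then obtain p' where p': "snd (traverse N ?u (Some ?q)) = Some p'"
      by (simp add: traverse_def Let_def)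
    then have "?W (Suc m) = (fst (traverse N ?u (Some ?q)), p')"
      unfolding walk same_port by (simp add: split_beta)
    then show ?thesis
      using pos entry p' by simp
  qed
qed

text \<open>The agent beeps after its move, so the beep of block \<open>m\<close> sounds at the node
  reached by step \<open>Suc m\<close>.\<close>

lemma destination_exploring:
  assumes "wake (A i) \<le> B"
    and phase: "\<And>j. j < 3 * R n \<Longrightarrow> phase (B + j) i = Some j"
    and search: "\<And>t. t < B + 3 * R n \<Longrightarrow> searching t i"
    and "m < R n"
  shows "destination (B + 3 * m) i = fst (exp_walk x N (position B i) (Suc m))"
proof -
  let ?t = "B + 3 * m"
  let ?u = "position ?t i"
  have ph: "phase ?t i = Some (3 * m)"
    using assms by simp
  have arr: "arrival alg N (conf ?t) i =
      traverse N ?u (Some (exp_port x m (entry_port (mem ?t i)) (degree_of N ?u)))"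
    using search[of ?t] \<open>m < R n\<close>
    by (simp add: arrival_def act_searching ph beeping_exploration_def)
  have walk: "?u = fst (exp_walk x N (position B i) m)"
      "m = 0 \<or> degree_of N ?u = 0 \<or>
        entry_port (mem ?t i) = snd (exp_walk x N (position B i) m)"
    using exploration_follows_walk[of i B m] assms by auto
  have "fst (exp_walk x N (position B i) (Suc m)) = fst (traverse N ?u
      (Some (exp_port x m (snd (exp_walk x N (position B i) m)) (degree_of N ?u))))"
    by (simp add: walk(1) split_beta Let_def)
  also have "\<dots> = destination ?t i"
    \<comment> \<open>If the entry ports differ, then either the step takes port 0 anyway or the
      node has degree 0 and the agent stays.\<close>
    using walk(2) unfolding arr by (auto simp: exp_port_def traverse_def)
  finally show ?thesis ..
qed

lemma waiting_stays:
  assumes "wake (A i) \<le> B"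
    and "\<And>j. j < l \<Longrightarrow> phase (B + j) i = None"
    and "\<And>t. t < B + l \<Longrightarrow> searching t i"
    and "j < l"
  shows "destination (B + j) i = position B i"
  using \<open>j < l\<close>
proof (induction j)
  case 0
  then show ?case
    using assms(2)[of 0] assms(3)[of B] by (simp add: arrival_def act_searching)
next
  case (Suc j)
  then have "position (B + Suc j) i = position B i"
    using assms(1) by (simp add: conf_Suc)
  then show ?case
    using Suc.prems assms(2)[of "Suc j"] assms(3)[of "B + Suc j"]
    by (simp add: arrival_def act_searching)
qed

section \<open>Existence of an early contact\<close>

text \<open>Without a contact both agents would search throughout, so the walk would be complete and
  would beep at the node of the waiting agent, which is a contact.\<close>

lemma contact_in_undisturbed_exploration:
  assumes awake: "wake (A i) \<le> B" "wake (A (\<not> i)) \<le> B"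
    and exploring_phase: "\<And>j. j < 3 * R n \<Longrightarrow> phase (B + j) i = Some j"
    and waiting_phase: "\<And>j. j < 3 * R n \<Longrightarrow> phase (B + j) (\<not> i) = None"
  shows "\<exists>t i. t < B + 3 * R n \<and> contact t i"
proof (rule ccontr)
  assume none: "\<not> ?thesis"
  have search: "searching t k" if "t < B + 3 * R n" for t k
  proof -
    have "\<not> contact s l" if "s < t" for s l
      using none \<open>t < B + 3 * R n\<close> that less_trans by blast
    then show ?thesis
      using searching_before_contact by blast
  qed
  obtain l where "l \<in> {1..R n}" and l: "fst (exp_walk x N (position B i) l) = position B (\<not> i)"
    using exploring position_in_nodes by blast
  \<comment> \<open>Visits count from step 1 on, so the visit is the arrival in some block
    \<open>m\<close>.\<close>
  then obtain m where m: "l = Suc m" "m < R n"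
    by (cases l) auto
  have "destination (B + 3 * m) (\<not> i) = position B (\<not> i)"
    using m(2) by (intro waiting_stays[OF awake(2) waiting_phase search]) auto
  then have "destination (B + 3 * m) i = destination (B + 3 * m) (\<not> i)"
    using destination_exploring[OF awake(1) exploring_phase search m(2)] l unfolding m(1) by simp
  then have "contact (B + 3 * m) i"
    using awake search m exploring_phase[of "3 * m"] waiting_phase[of "3 * m"]
    by (simp add: contact_def)
  then show False
    using none m(2) by auto
qed

lemma contact_early:
  "\<exists>t i. contact t i \<and> t < max (wake (A False)) (wake (A True)) +
     6 * R n + 6 * max (label (A False)) (label (A True)) * R n"
proof -
  define w l where "w = max (wake (A False)) (wake (A True))"
    and "l = max (label (A False)) (label (A True))"
  obtain a where a: "wake (A a) \<le> wake (A (\<not> a))"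
    by (cases "wake (A False) \<le> wake (A True)") (use that[of False] that[of True] in auto)
  have label_le: "6 * label (A i) * R n \<le> 6 * l * R n" for i
    by (cases i) (auto simp: l_def intro!: mult_right_mono)
  have w_eq: "wake (A (\<not> a)) = w"
    using a by (cases a) (auto simp: w_def)
  \<comment> \<open>This merges both outcomes: \<open>i\<close> is whichever agent explores
    undisturbed.\<close>
  have "\<exists>i B. wake (A i) \<le> B \<and> wake (A (\<not> i)) \<le> B \<and>
      B \<le> wake (A (\<not> a)) + 3 * R n + 6 * label (A i) * R n \<and>
      (\<forall>j < 3 * R n. phase (B + j) i = Some j \<and> phase (B + j) (\<not> i) = None)"
    using a label_neq[of a] label_pos[of a] label_pos[of "\<not> a"]
  proof (cases rule: undisturbed_exploration[where r = "R n"])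
    case (earlier B)
    then show ?thesis
      using a by (intro exI[of _ a] exI[of _ B] conjI allI impI) (simp_all add: phase_def)
  next
    case (later B)
    then show ?thesis
      using a by (intro exI[of _ "\<not> a"] exI[of _ B] conjI allI impI) (simp_all add: phase_def)
  qed
  then obtain i B where "wake (A i) \<le> B" "wake (A (\<not> i)) \<le> B"
      and B: "B \<le> w + 3 * R n + 6 * label (A i) * R n"
      and "\<And>j. j < 3 * R n \<Longrightarrow> phase (B + j) i = Some j"
      "\<And>j. j < 3 * R n \<Longrightarrow> phase (B + j) (\<not> i) = None"
    unfolding w_eq by blast
  then obtain t k where "t < B + 3 * R n" "contact t k"
    using contact_in_undisturbed_exploration by blast
  moreover from this(1) have "t < w + 6 * R n + 6 * l * R n"
    using B label_le[of i] by linarith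
  ultimately show ?thesis
    unfolding w_def l_def by blast
qed

section \<open>From a contact to the simultaneous declaration\<close>

lemma declare_after_contact:
  assumes "contact t i"
  shows "position (t + 3) i = position (t + 3) (\<not> i)"
    and "mode (mem (t + 3) i) = Declaring" and "mode (mem (t + 3) (\<not> i)) = Declaring"
proof -
  let ?o = "\<not> i"
  from assms obtain j where awake: "wake (A i) \<le> t" "wake (A ?o) \<le> t"
    and search: "searching t i" "searching t ?o"
    and j: "phase t i = Some j" "j mod 3 = 0" and wait: "phase t ?o = None"
    and dest: "destination t i = destination t ?o"
    by (auto simp: contact_def)
  have j1: "phase (Suc t) i = Some (Suc j)"
    using exploration_round_Suc[of "R n" "label (A i)" "t - wake (A i)" j] j awake
    by (simp add: phase_def Suc_diff_le)
  have j2: "phase (Suc (Suc t)) i = Some (Suc (Suc j))"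
    using exploration_round_Suc[of "R n" "label (A i)" "Suc t - wake (A i)" "Suc j"] j j1 awake
    by (simp add: phase_def Suc_diff_le mod_Suc)
  have beep: "beeps (act alg N (conf t) i)" "\<not> beeps (act alg N (conf t) ?o)"
    using j wait by (simp_all add: beeps_searching search)
  have hear0: "\<not> hears_at t i" "hears_at t ?o"
    using beep awake dest by (simp_all add: hears_beep_def)
  \<comment> \<open>The explorer beeps and hence hears nothing in round \<open>t\<close>. This
    clears \<open>heard_last\<close>, so the first answer alone cannot stop it.\<close>
  have mode1: "mode (mem (Suc t) i) = Searching" "mode (mem (Suc t) ?o) = Answer1"
    and heard1: "\<not> heard_last (mem (Suc t) i)"
    using search hear0 awake wait
    by (simp_all add: conf_Suc rv_update_def stop_condition_def searching_def)
  have pos1: "position (Suc t) i = position (Suc t) ?o"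
    using dest awake by (simp add: conf_Suc)
  have act1: "act alg N (conf (Suc t)) i = stay_and_listen"
      "act alg N (conf (Suc t)) ?o = stay_and_listen\<lparr>beeps := True\<rparr>"
    using mode1 j j1 by (simp_all add: act_eq rv_choose_def phase_def[symmetric]
        beeping_exploration_def mod_Suc)
  have arr1: "arrival alg N (conf (Suc t)) k = (position (Suc t) k, None)" for k
    using act1 by (intro arrival_staying) (cases "k = i"; simp)
  have hear1: "hears_at (Suc t) i"
    using act1 awake pos1 by (simp add: hears_beep_def arr1)
  have mode2: "mode (mem (Suc (Suc t)) i) = Searching" "mode (mem (Suc (Suc t)) ?o) = Answer2"
    and heard2: "heard_last (mem (Suc (Suc t)) i)"
    using mode1 heard1 hear1 awake j1
    by (simp_all add: conf_Suc(2)[of _ "Suc t"] rv_update_def stop_condition_def)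
  have pos2: "position (Suc (Suc t)) i = position (Suc (Suc t)) ?o"
    using pos1 awake by (simp add: conf_Suc(1)[of _ "Suc t"] arr1)
  have act2: "act alg N (conf (Suc (Suc t))) i = stay_and_listen"
      "act alg N (conf (Suc (Suc t))) ?o = stay_and_listen\<lparr>beeps := True\<rparr>"
    using mode2 j j2 by (simp_all add: act_eq rv_choose_def phase_def[symmetric]
        beeping_exploration_def mod_Suc)
  have arr2: "arrival alg N (conf (Suc (Suc t))) k = (position (Suc (Suc t)) k, None)" for k
    using act2 by (intro arrival_staying) (cases "k = i"; simp)
  have hear2: "hears_at (Suc (Suc t)) i"
    using act2 awake pos2 by (simp add: hears_beep_def arr2)
  have t3: "t + 3 = Suc (Suc (Suc t))" by simp
  show "mode (mem (t + 3) i) = Declaring" "mode (mem (t + 3) ?o) = Declaring"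
    unfolding t3 using mode2 heard2 hear2 awake j2
    by (simp_all add: conf_Suc(2)[of _ "Suc (Suc t)"] rv_update_def stop_condition_def)
  show "position (t + 3) i = position (t + 3) ?o"
    unfolding t3 using pos2 awake by (simp add: conf_Suc(1)[of _ "Suc (Suc t)"] arr2)
qed

lemma rendezvous:
  "\<exists>t \<le> max (wake (A False)) (wake (A True)) +
       (12 * R n + 3) * max (label (A False)) (label (A True)).
     meet_in_round alg N A t \<and> declares_in_round alg N A False t \<and> declares_in_round alg N A True t"
proof -
  define w l where "w = max (wake (A False)) (wake (A True))"
    and "l = max (label (A False)) (label (A True))"
  obtain t i where c: "contact t i" and t: "t < w + 6 * R n + 6 * l * R n"
    using contact_early unfolding w_def l_def by blast
  have awake: "wake (A k) \<le> t + 3" for k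
    using c by (cases "k = i") (auto simp: contact_def)
  have mode: "mode (mem (t + 3) k) = Declaring" for k
    using declare_after_contact[OF c] by (cases "k = i") auto
  have pos: "position (t + 3) False = position (t + 3) True"
    using declare_after_contact(1)[OF c] by (cases i) auto
  have act: "act alg N (conf (t + 3)) k = stay_and_listen\<lparr>declares := True\<rparr>" for k
    using mode by (simp add: act_eq rv_choose_def)
  have "meet_in_round alg N A (t + 3) \<and>
      declares_in_round alg N A False (t + 3) \<and> declares_in_round alg N A True (t + 3)"
    using awake pos
    by (simp add: meet_in_round_def declares_in_round_def arrival_staying act)
  \<comment> \<open>Since \<open>l \<ge> 1\<close>, the additive \<open>6 * R n + 3\<close> is
    absorbed into a multiple of \<open>l\<close>.\<close>
  moreover have "t + 3 \<le> w + (12 * R n + 3) * l"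
  proof -
    have "1 \<le> l" using label_pos[of False] by (simp add: l_def)
    then have "6 * R n + 3 \<le> (6 * R n + 3) * l" by simp
    moreover have "(12 * R n + 3) * l = (6 * R n + 3) * l + 6 * l * R n"
      by (simp add: algebra_simps)
    moreover have "t + 3 \<le> w + (q + p)" if "6 * R n + 3 \<le> q" "t < w + 6 * R n + p" for p q
      using that by linarith
    ultimately show ?thesis
      using t by metis
  qed
  ultimately show ?thesis unfolding w_def l_def by blast
qed

end

theorem theorem4p1:
  fixes x R :: "nat \<Rightarrow> nat" and n :: nat
  assumes "exploration_procedure x R" and "n \<ge> 1"
  shows "\<exists>c \<ge> 1.
    (\<forall>(N :: nat port_graph) A. admissible n N A \<longrightarrow>
       (\<forall>i. c_bounded c (bounded_energy_RV x R n) N A i)) \<and>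
    (\<exists>K :: nat. \<forall>(N :: nat port_graph) A. admissible n N A \<longrightarrow>
       (\<exists>t \<le> max (wake (A False)) (wake (A True)) + K * max (label (A False)) (label (A True)).
          meet_in_round (bounded_energy_RV x R n) N A t \<and>
          declares_in_round (bounded_energy_RV x R n) N A False t \<and>
          declares_in_round (bounded_energy_RV x R n) N A True t))"
proof -
  have run: "rv_execution x R n N A" if "admissible n N A" for N :: "nat port_graph" and A
  proof
    show "\<exists>i \<in> {1..R n}. fst (exp_walk x N v i) = w" if "v \<in> nodes N" "w \<in> nodes N" for v w
    proof -
      have "port_labelled_graph N \<and> card (nodes N) \<le> n"
        using \<open>admissible n N A\<close> by (simp add: admissible_def)
      then show ?thesis
        using assms that unfolding exploration_procedure_def by blast
    qed
  qed (fact that)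
  show ?thesis
  \<comment> \<open>The summand 1 gives \<open>c \<ge> 1\<close> whatever \<open>R n\<close>
    is.\<close>
  proof (rule exI[of _ "6 * R n + 1"], intro conjI)
    show "1 \<le> 6 * R n + 1" by simp
    show "\<forall>(N :: nat port_graph) A. admissible n N A \<longrightarrow>
       (\<forall>i. c_bounded (6 * R n + 1) (bounded_energy_RV x R n) N A i)"
      using rv_execution.c_bounded_energy[OF run] by (fastforce simp: c_bounded_def)
  qed (use rv_execution.rendezvous[OF run] in blast)
qed

end
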